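(* Let $\Lambda=\{\lambda_k\}_{k\ge 0}$ be a non-decreasing sequence of positive numbers tending to $\infty$, let $r\ge 2$ be an integer and let $1\le p<\infty$. If $f\in S^p(\Lambda^r)$, then $$\lim_{m\to\infty}\|s_m(f)-f\|_{S^p(\Lambda^r)}=0.$$
   Context: $L^p$ is the usual Banach space of (classes of a.e. equal) $2\pi$-periodic complex-valued measurable functions with $|f|^p$ integrable over a period, with its usual norm $\|\cdot\|_p$. For $f\in L^p$ with Fourier series $\frac12a_0(f)+\sum_{k\ge1}(a_k(f)\cos kt+b_k(f)\sin kt)$, $s_k(f)$ denotes the $k$th partial sum (so $s_0(f)=\frac12a_0(f)$). Convention: $\lambda_{-1}=\dots=\lambda_{-r}=0$ and $s_{-1}(f)=\dots=s_{-r}(f)=0$. A function $f\in L^p$ belongs to $S^p(\Lambda^r)$ if $$\lim_{n\to\infty}\left\|\frac1{\lambda_n}\sum_{k=0}^n|\lambda_k(s_k(f)-f)-\lambda_{k-r}(s_{k-r}(f)-f)|\right\|_p=0.$$ The norm is $$\|f\|_{S^p(\Lambda^r)}=\sup_{n\ge0}\left\|\frac1{\lambda_n}\sum_{k=0}^n|\lambda_k s_k(f)-\lambda_{k-r}s_{k-r}(f)|\right\|_p.$$ *)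

theory Defs
  imports "HOL-Analysis.Analysis"
begin

abbreviation period_measure :: "real measure" where
  "period_measure \<equiv> lebesgue_on {-pi..pi}"

text \<open>Elements of \<open>L\<^sup>p\<close> are handled through everywhere \<open>2\<pi>\<close>-periodic representatives
  \<open>real \<Rightarrow> complex\<close>; changing the representative on a null set affects neither
  the Fourier coefficients nor any of the norms below.\<close>

definition Lp_space :: "real \<Rightarrow> (real \<Rightarrow> complex) set" where
  "Lp_space p = {f. f \<in> borel_measurable lebesgue \<and> (\<forall>x. f (x + 2 * pi) = f x) \<and>
     integrable period_measure (\<lambda>x. norm (f x) powr p)}"

text \<open>The Bochner integral of a non-integrable function is \<open>0\<close>, so this is the
  \<open>L\<^sup>p\<close> norm only for functions whose \<open>p\<close>-th power is integrable over a period.\<close>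

definition Lp_norm :: "real \<Rightarrow> (real \<Rightarrow> 'a::real_normed_vector) \<Rightarrow> real" where
  "Lp_norm p g = (\<integral>x. norm (g x) powr p \<partial>period_measure) powr (1 / p)"

definition fourier_cos_coeff :: "(real \<Rightarrow> complex) \<Rightarrow> nat \<Rightarrow> complex" where
  "fourier_cos_coeff f k = (\<integral>t. f t * of_real (cos (real k * t)) \<partial>period_measure) / of_real pi"

definition fourier_sin_coeff :: "(real \<Rightarrow> complex) \<Rightarrow> nat \<Rightarrow> complex" where
  "fourier_sin_coeff f k = (\<integral>t. f t * of_real (sin (real k * t)) \<partial>period_measure) / of_real pi"

definition fourier_partial_sum :: "nat \<Rightarrow> (real \<Rightarrow> complex) \<Rightarrow> real \<Rightarrow> complex" where
  "fourier_partial_sum n f x = fourier_cos_coeff f 0 / 2 +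
     (\<Sum>k=1..n. fourier_cos_coeff f k * of_real (cos (real k * x))
              + fourier_sin_coeff f k * of_real (sin (real k * x)))"

text \<open>The convention that sequences indexed by the natural numbers vanish at negative indices.\<close>

definition zero_ext :: "(nat \<Rightarrow> 'a::zero) \<Rightarrow> int \<Rightarrow> 'a" where
  "zero_ext a i = (if i < 0 then 0 else a (nat i))"

definition strong_deviation ::
    "(nat \<Rightarrow> real) \<Rightarrow> nat \<Rightarrow> (real \<Rightarrow> complex) \<Rightarrow> nat \<Rightarrow> real \<Rightarrow> real" where
  "strong_deviation l r f n x = 1 / l n * (\<Sum>k=0..n. norm (
       of_real (zero_ext l (int k))
         * (zero_ext (\<lambda>j. fourier_partial_sum j f x) (int k) - f x)
     - of_real (zero_ext l (int k - int r))
         * (zero_ext (\<lambda>j. fourier_partial_sum j f x) (int k - int r) - f x)))"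

definition strong_mean ::
    "(nat \<Rightarrow> real) \<Rightarrow> nat \<Rightarrow> (real \<Rightarrow> complex) \<Rightarrow> nat \<Rightarrow> real \<Rightarrow> real" where
  "strong_mean l r f n x = 1 / l n * (\<Sum>k=0..n. norm (
       of_real (zero_ext l (int k))
         * zero_ext (\<lambda>j. fourier_partial_sum j f x) (int k)
     - of_real (zero_ext l (int k - int r))
         * zero_ext (\<lambda>j. fourier_partial_sum j f x) (int k - int r)))"

definition Sp_space :: "real \<Rightarrow> (nat \<Rightarrow> real) \<Rightarrow> nat \<Rightarrow> (real \<Rightarrow> complex) set" where
  "Sp_space p l r = {f \<in> Lp_space p. (\<lambda>n. Lp_norm p (strong_deviation l r f n)) \<longlonglongrightarrow> 0}"

text \<open>Valued in the extended nonnegative reals, so that the supremum is meaningful without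
  a boundedness assumption.\<close>

definition Sp_norm :: "real \<Rightarrow> (nat \<Rightarrow> real) \<Rightarrow> nat \<Rightarrow> (real \<Rightarrow> complex) \<Rightarrow> ennreal" where
  "Sp_norm p l r f = (SUP n. ennreal (Lp_norm p (strong_mean l r f n)))"

end

theory Submission
  imports Defs
begin

text \<open>
  Write \<open>d\<^sub>k = \<lambda>\<^sub>k (s\<^sub>k - f) - \<lambda>\<^bsub>k-r\<^esub> (s\<^bsub>k-r\<^esub> - f)\<close> and let
  \<open>dev\<^sub>n\<close> be the strong deviation of \<open>f\<close>. Telescoping \<open>d\<close> along steps of length \<open>r\<close> gives
  \<open>\<bar>s\<^sub>n - f\<bar> \<le> dev\<^sub>n\<close> pointwise. The partial sums of \<open>s\<^sub>m - f\<close> are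
  \<open>s\<^bsub>min k m\<^esub> - s\<^sub>k\<close>, so their lagged differences vanish for \<open>k \<le> m\<close> and equal
  \<open>(\<lambda>\<^sub>k - \<lambda>\<^bsub>k-r\<^esub>) (s\<^sub>m - f) - d\<^sub>k\<close> for \<open>k \<ge> m + r\<close>; for the remaining indices they are
  \<open>\<lambda>\<^sub>k (s\<^sub>m - f) - \<lambda>\<^sub>k (s\<^sub>k - f)\<close>. As the sum of \<open>\<lambda>\<^sub>k - \<lambda>\<^bsub>k-r\<^esub>\<close> over \<open>k \<le> n\<close> is at most
  \<open>r \<lambda>\<^sub>n\<close>, the \<open>n\<close>th strong mean of \<open>s\<^sub>m - f\<close> is pointwise at most \<open>2r + 2\<close> times
  a sum of at most \<open>r + 1\<close> deviations \<open>dev\<^sub>k\<close> with \<open>k \<ge> m\<close>, whose norms are small uniformly in \<open>n\<close>.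
\<close>

section \<open>Orthogonality of the trigonometric system over a period\<close>

text \<open>The hypothesis \<open>sin (c * pi) = 0\<close> stands for integrality of
  \<open>c\<close>: it makes both boundary values of the antiderivative
  \<open>sin (c * t) / c\<close> vanish, and it is easily checked for sums and differences of
  frequencies taken in the reals.\<close>

lemma integral_cos_period:
  fixes c :: real
  assumes "sin (c * pi) = 0"
  shows "(\<integral>t. cos (c * t) \<partial>period_measure) = (if c = 0 then 2 * pi else 0)"
proof (cases "c = 0")
  case True
  then show ?thesis by (simp add: measure_restrict_space)
next
  case False
  have "((\<lambda>t. cos (c * t)) has_integral (sin (c * pi) / c - sin (c * (- pi)) / c)) {-pi..pi}"
    using False
    by (intro fundamental_theorem_of_calculus)
       (auto intro!: derivative_eq_intros simp flip: has_real_derivative_iff_has_vector_derivative)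
  moreover have "integrable period_measure (\<lambda>t. cos (c * t))"
    by (intro continuous_imp_integrable_real continuous_intros)
  ultimately show ?thesis
    using False assms by (simp add: lebesgue_integral_eq_integral integral_unique)
qed

text \<open>The antiderivative \<open>- cos (c * t) / c\<close> is even, so its boundary values at
  \<open>-pi\<close> and \<open>pi\<close> cancel for every real \<open>c\<close>.\<close>

lemma integral_sin_period:
  fixes c :: real
  shows "(\<integral>t. sin (c * t) \<partial>period_measure) = 0"
proof (cases "c = 0")
  case False
  have "((\<lambda>t. sin (c * t)) has_integral (- cos (c * pi) / c - (- cos (c * (- pi)) / c))) {-pi..pi}"
    using False
    by (intro fundamental_theorem_of_calculus)
       (auto intro!: derivative_eq_intros simp flip: has_real_derivative_iff_has_vector_derivative)
  moreover have "integrable period_measure (\<lambda>t. sin (c * t))"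
    by (intro continuous_imp_integrable_real continuous_intros)
  ultimately show ?thesis
    using False by (simp add: lebesgue_integral_eq_integral integral_unique)
qed simp

lemma sin_nat_combination_pi: "sin ((real j - real k) * pi) = 0" "sin ((real j + real k) * pi) = 0"
  by (simp_all add: distrib_right left_diff_distrib sin_add sin_diff)

lemma integrable_cos_sin [simp]:
  "integrable period_measure (\<lambda>t. cos (c * t))" "integrable period_measure (\<lambda>t. sin (c * t))"
  for c :: real
  by (intro continuous_imp_integrable_real continuous_intros)+

lemma integral_cos_cos:
  "(\<integral>t. cos (real j * t) * cos (real k * t) \<partial>period_measure)
     = (if j = k then if k = 0 then 2 * pi else pi else 0)"
proof -
  have "(\<lambda>t. cos (real j * t) * cos (real k * t))
      = (\<lambda>t. (cos ((real j - real k) * t) + cos ((real j + real k) * t)) / 2)"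
    by (simp add: cos_times_cos algebra_simps)
  then show ?thesis
    by (auto simp: integral_cos_period sin_nat_combination_pi)
qed

lemma integral_sin_sin:
  "(\<integral>t. sin (real j * t) * sin (real k * t) \<partial>period_measure)
     = (if j = k \<and> k \<noteq> 0 then pi else 0)"
proof -
  have "(\<lambda>t. sin (real j * t) * sin (real k * t))
      = (\<lambda>t. (cos ((real j - real k) * t) - cos ((real j + real k) * t)) / 2)"
    by (simp add: sin_times_sin algebra_simps)
  then show ?thesis
    by (auto simp: integral_cos_period sin_nat_combination_pi)
qed

lemma integral_sin_cos:
  "(\<integral>t. sin (real j * t) * cos (real k * t) \<partial>period_measure) = 0"
proof -
  have "(\<lambda>t. sin (real j * t) * cos (real k * t))
      = (\<lambda>t. (sin ((real j + real k) * t) + sin ((real j - real k) * t)) / 2)"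
    by (simp add: sin_times_cos left_diff_distrib distrib_right)
  then show ?thesis
    by (auto simp: integral_sin_period)
qed

section \<open>Elementary inequalities for sums and lagged differences\<close>

text \<open>The sum is at most \<open>card B\<close> times its largest term, and the power of that
  term is one of the summands on the right. This crude form of convexity suffices, since only sums
  of boundedly many deviations will be estimated.\<close>

lemma sum_powr_le:
  fixes b :: "'a \<Rightarrow> real"
  assumes "finite B" "\<And>k. k \<in> B \<Longrightarrow> 0 \<le> b k" "0 \<le> p"
  shows "(\<Sum>k\<in>B. b k) powr p \<le> real (card B) powr p * (\<Sum>k\<in>B. b k powr p)"
proof (cases "B = {}")
  case False
  define M where "M = Max (b ` B)"
  have M: "M \<in> b ` B" "\<And>k. k \<in> B \<Longrightarrow> b k \<le> M"
    using assms(1) False by (auto simp: M_def)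
  then obtain i where i: "i \<in> B" "M = b i" by auto
  have "(\<Sum>k\<in>B. b k) powr p \<le> (real (card B) * M) powr p"
    using assms M sum_bounded_above[of B b M] by (intro powr_mono2) (auto intro: sum_nonneg)
  also have "\<dots> = real (card B) powr p * b i powr p"
    using assms i by (simp add: powr_mult)
  also have "\<dots> \<le> real (card B) powr p * (\<Sum>k\<in>B. b k powr p)"
    using assms(1) i by (intro mult_left_mono member_le_sum) auto
  finally show ?thesis .
qed simp

text \<open>Descending from \<open>k\<close> in steps of \<open>r\<close>, the lagged differences
  telescope to \<open>l k * E k\<close>; the descent ends below \<open>r\<close>, where the
  difference is the term itself. The other residue classes only enlarge the right-hand side.\<close>

lemma norm_le_sum_lag_diff:
  fixes l :: "nat \<Rightarrow> real" and E :: "nat \<Rightarrow> complex"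
  assumes "0 < r" "\<And>k. 0 < l k"
  shows "l k * norm (E k) \<le>
    (\<Sum>i\<le>k. norm (l i * E i - (if i < r then 0 else l (i - r) * E (i - r))))"
    (is "_ \<le> (\<Sum>i\<le>k. norm (?D i))")
proof (induction k rule: less_induct)
  case (less k)
  show ?case
  proof (cases "k < r")
    case True
    have "norm (?D k) \<le> (\<Sum>i\<le>k. norm (?D i))"
      by (rule member_le_sum) auto
    then show ?thesis using True assms(2)[of k] by (simp add: norm_mult)
  next
    case False
    have "l k * norm (E k) = norm (?D k + l (k - r) * E (k - r))"
      using False assms(2)[of k] by (simp add: norm_mult)
    also have "\<dots> \<le> norm (?D k) + l (k - r) * norm (E (k - r))"
      using assms(2)[of "k - r"] by (intro order.trans[OF norm_triangle_ineq]) (simp add: norm_mult)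
    also have "\<dots> \<le> norm (?D k) + (\<Sum>i\<le>k - r. norm (?D i))"
      using less[of "k - r"] False assms(1) by simp
    \<comment> \<open>Since \<open>r\<close> is positive, \<open>k\<close> lies outside
      \<open>{..k - r}\<close>, so no term is counted twice.\<close>
    also have "\<dots> = (\<Sum>i\<in>insert k {..k - r}. norm (?D i))"
      using False assms(1) by (subst sum.insert) auto
    also have "\<dots> \<le> (\<Sum>i\<le>k. norm (?D i))"
      by (rule sum_mono2) auto
    finally show ?thesis .
  qed
qed

text \<open>After cancellation only the last \<open>r\<close> values of \<open>l\<close> survive
  (all of them if there are fewer, where \<open>Suc n - r\<close> truncates to 0), and by
  monotonicity each is at most \<open>l n\<close>.\<close>

lemma sum_lag_diff_le:
  fixes l :: "nat \<Rightarrow> real"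
  assumes "mono l" "\<And>k. 0 < l k"
  shows "(\<Sum>k\<le>n. l k - (if k < r then 0 else l (k - r))) \<le> real r * l n"
proof -
  have *: "(\<Sum>k\<le>n. (if k < r then 0 else l (k - r))) = (\<Sum>k<Suc n - r. l k)"
  proof -
    have "(\<Sum>k\<le>n. (if k < r then 0 else l (k - r))) = (\<Sum>k=r..n. l (k - r))"
      by (intro sum.mono_neutral_cong_right) auto
    also have "\<dots> = (\<Sum>k<Suc n - r. l k)"
      by (rule sum.reindex_bij_witness[where i="\<lambda>k. k + r" and j="\<lambda>k. k - r"]) auto
    finally show ?thesis .
  qed
  have "(\<Sum>k\<le>n. l k) = (\<Sum>k<Suc n - r. l k) + (\<Sum>k=Suc n - r..n. l k)"
    by (subst sum.union_disjoint[symmetric]) (auto intro!: sum.cong)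
  then have "(\<Sum>k\<le>n. l k - (if k < r then 0 else l (k - r))) = (\<Sum>k=Suc n - r..n. l k)"
    using * by (simp add: sum_subtractf)
  also have "\<dots> \<le> real (card {Suc n - r..n}) * l n"
    using monoD[OF assms(1)] by (intro sum_bounded_above) auto
  also have "\<dots> \<le> real r * l n"
    using assms(2)[of n] by (intro mult_right_mono) auto
  finally show ?thesis .
qed

text \<open>The whole estimate at one fixed point, as a statement about numbers: \<open>S\<close>
  holds the values of the partial sums of a function, \<open>F\<close> its own value,
  \<open>G\<close> the partial sums of the \<open>m\<close>th remainder, and \<open>dev\<close> the
  strong deviations.\<close>

lemma lag_mean_truncation_le:
  fixes l :: "nat \<Rightarrow> real" and S :: "nat \<Rightarrow> complex" and F :: complex
    and r m n :: nat and D G :: "nat \<Rightarrow> complex" and dev :: "nat \<Rightarrow> real"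
  defines "D \<equiv> \<lambda>i. l i * (S i - F) - (if i < r then 0 else l (i - r) * (S (i - r) - F))"
  defines "G \<equiv> \<lambda>k. S (min k m) - S k"
  defines "dev \<equiv> \<lambda>n. 1 / l n * (\<Sum>k\<le>n. norm (D k))"
  assumes "mono l" "\<And>k. 0 < l k" "0 < r" "m \<le> n"
  shows "1 / l n * (\<Sum>k\<le>n. norm (l k * G k - (if k < r then 0 else l (k - r) * G (k - r))))
    \<le> (2 * real r + 2) * (\<Sum>k\<in>insert n {m..<m+r}. dev k)" (is "1 / l n * (\<Sum>k\<le>n. norm (?T k)) \<le> _")
proof -
  let ?B = "insert n {m..<m+r}"
  define E where "E = (\<lambda>k. norm (S k - F))"
  \<comment> \<open>\<open>H\<close> covers the transitional indices, where \<open>k\<close> is past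
    \<open>m\<close> but \<open>k - r\<close> is not. Its weight in the bound below is
    \<open>l n\<close> rather than \<open>l k\<close>, so that it can be taken out of the
    sum.\<close>
  define H where "H = (\<lambda>k. if k \<in> {m<..<m+r} then E m + E k else 0)"
  have Dnn: "0 \<le> dev k" for k
    unfolding dev_def using assms(5)[of k] by (intro mult_nonneg_nonneg sum_nonneg) auto
  have Edev: "E k \<le> dev k" for k
    using norm_le_sum_lag_diff[of r l k "\<lambda>i. S i - F"] assms(5)[of k] assms(5,6)
    by (simp add: E_def dev_def D_def field_simps)
  have mono: "l i \<le> l j" if "i \<le> j" for i j using monoD[OF assms(4) that] .
  have Enn: "0 \<le> E k" for k by (simp add: E_def)
  have T: "norm (?T k) \<le> norm (D k) + (l k - (if k < r then 0 else l (k - r))) * E m + l n * H k"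
    if "k \<le> n" for k
  proof -
    have nn: "0 \<le> (l k - (if k < r then 0 else l (k - r))) * E m" "0 \<le> l n * H k" "0 \<le> l k - (if k < r then 0 else l (k - r))"
      using mono[of "k - r" k] Enn assms(5)[of k] assms(5)[of n] by (auto simp: H_def intro!: mult_nonneg_nonneg)
    consider "k \<le> m" | "m < k" "k < m + r" | "m + r \<le> k" by linarith
    then show ?thesis
    proof cases
      case 1
      then have "?T k = 0" by (auto simp: G_def)
      then show ?thesis using nn by simp
    next
      case 2
      \<comment> \<open>The lagged index is below \<open>m\<close>, where \<open>min\<close> has no
        effect and \<open>G\<close> vanishes; if \<open>k < r\<close>, there is no lagged term at
        all.\<close>
      then have "?T k = l k * G k" by (auto simp: G_def)
      moreover have "G k = (S m - F) - (S k - F)" using 2 by (simp add: G_def)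
      ultimately have "norm (?T k) = l k * norm ((S m - F) - (S k - F))"
        using assms(5)[of k] by (simp only: norm_mult norm_of_real abs_of_pos)
      also have "\<dots> \<le> l k * (E m + E k)"
        unfolding E_def using assms(5)[of k] by (intro mult_left_mono norm_triangle_ineq4) simp
      also have "\<dots> \<le> l n * H k"
        using 2 Enn[of m] Enn[of k] mono[OF that] by (auto simp: H_def intro!: mult_right_mono)
      finally have "norm (?T k) \<le> l n * H k" .
      then show ?thesis using nn by (smt (verit) norm_ge_zero)
    next
      case 3
      \<comment> \<open>Both indices are at least \<open>m\<close>, so \<open>G\<close> is
        \<open>(S m - F) - (S i - F)\<close> at \<open>i = k\<close> and at
        \<open>i = k - r\<close>; the second parts combine to \<open>D k\<close>.\<close>
      then have "?T k = (l k - l (k - r)) * (S m - F) - D k"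
        by (auto simp: G_def D_def algebra_simps)
      then have "norm (?T k) \<le> norm ((l k - l (k - r)) * (S m - F)) + norm (D k)"
        by (metis norm_triangle_ineq4)
      also have "norm ((l k - l (k - r)) * (S m - F)) = (l k - l (k - r)) * E m"
        using mono[of "k - r" k] by (simp add: norm_mult E_def flip: of_real_diff)
      finally show ?thesis using 3 nn by auto
    qed
  qed
  have "(\<Sum>k\<le>n. norm (?T k)) \<le> (\<Sum>k\<le>n. norm (D k))
      + (\<Sum>k\<le>n. l k - (if k < r then 0 else l (k - r))) * E m + l n * (\<Sum>k\<le>n. H k)"
    using sum_mono[of "{..n}" "\<lambda>k. norm (?T k)", OF T]
    by (simp add: sum.distrib sum_distrib_left sum_distrib_right)
  also have "(\<Sum>k\<le>n. norm (D k)) = l n * dev n"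
    using assms(5)[of n] by (simp add: dev_def)
  also have "(\<Sum>k\<le>n. l k - (if k < r then 0 else l (k - r))) * E m \<le> (real r * l n) * E m"
    by (intro mult_right_mono sum_lag_diff_le assms Enn)
  also have "(\<Sum>k\<le>n. H k) \<le> (\<Sum>k\<in>{m..<m+r}. E m + E k)"
  proof -
    have "(\<Sum>k\<le>n. H k) = (\<Sum>k\<in>{..n} \<inter> {m<..<m+r}. E m + E k)"
      unfolding H_def by (subst sum.inter_restrict) auto
    \<comment> \<open>Adding the index \<open>m\<close> makes the window have exactly
      \<open>r\<close> elements, which yields a second multiple \<open>real r * E m\<close>.\<close>
    also have "\<dots> \<le> (\<Sum>k\<in>{m..<m+r}. E m + E k)"
      using Enn by (intro sum_mono2) auto
    finally show ?thesis .
  qed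
  also have "\<dots> = real r * E m + (\<Sum>k\<in>{m..<m+r}. E k)"
    by (simp add: sum.distrib)
  finally have "1 / l n * (\<Sum>k\<le>n. norm (?T k)) \<le> dev n + 2 * real r * E m + (\<Sum>k\<in>{m..<m+r}. E k)"
    using assms(5)[of n] by (simp add: field_simps)
  \<comment> \<open>The three summands are at most 1, \<open>2 * real r\<close> and 1 times the full
    sum of deviations, whence the constant \<open>2 * real r + 2\<close>.\<close>
  also have "dev n + 2 * real r * E m + (\<Sum>k\<in>{m..<m+r}. E k)
      \<le> (\<Sum>k\<in>?B. dev k) + 2 * real r * (\<Sum>k\<in>?B. dev k) + (\<Sum>k\<in>?B. dev k)"
  proof (intro add_mono mult_left_mono)
    show "dev n \<le> (\<Sum>k\<in>?B. dev k)"
      using Dnn by (intro member_le_sum) auto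
    have "dev m \<le> (\<Sum>k\<in>?B. dev k)"
      using Dnn assms(6) by (intro member_le_sum) auto
    then show "E m \<le> (\<Sum>k\<in>?B. dev k)" using Edev[of m] by linarith
    have "(\<Sum>k\<in>{m..<m+r}. E k) \<le> (\<Sum>k\<in>{m..<m+r}. dev k)"
      by (intro sum_mono Edev)
    also have "\<dots> \<le> (\<Sum>k\<in>?B. dev k)"
      using Dnn by (intro sum_mono2) auto
    finally show "(\<Sum>k\<in>{m..<m+r}. E k) \<le> (\<Sum>k\<in>?B. dev k)" .
  qed simp
  finally show ?thesis by (simp add: algebra_simps)
qed

section \<open>Integrability of powers over a period and norm estimates\<close>

text \<open>Unlike \<open>Lp_space\<close>, this speaks of one period only and allows any Euclidean
  codomain, so it covers complex functions and the real-valued deviations alike.\<close>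

definition mem_Lp :: "real \<Rightarrow> (real \<Rightarrow> 'a::euclidean_space) \<Rightarrow> bool" where
  "mem_Lp p g \<longleftrightarrow> g \<in> borel_measurable period_measure \<and>
     integrable period_measure (\<lambda>x. norm (g x) powr p)"

lemma mem_Lp_mono:
  fixes g :: "real \<Rightarrow> 'a::euclidean_space" and h :: "real \<Rightarrow> 'b::euclidean_space"
  assumes "mem_Lp p g" "h \<in> borel_measurable period_measure" "\<And>x. norm (h x) \<le> norm (g x)" "0 \<le> p"
  shows "mem_Lp p h"
proof -
  have [measurable]: "h \<in> borel_measurable period_measure" by fact
  have "integrable period_measure (\<lambda>x. norm (h x) powr p)"
  proof (rule Bochner_Integration.integrable_bound)
    show "integrable period_measure (\<lambda>x. norm (g x) powr p)"
      using assms(1) by (simp add: mem_Lp_def)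
    show "AE x in period_measure. norm (norm (h x) powr p) \<le> norm (norm (g x) powr p)"
      using assms(3,4) by (simp add: powr_mono2)
  qed measurable
  then show ?thesis using assms by (simp add: mem_Lp_def)
qed

lemma mem_Lp_const: "mem_Lp p (\<lambda>x. c)"
  unfolding mem_Lp_def by auto

lemma mem_Lp_norm: "mem_Lp p g \<Longrightarrow> mem_Lp p (\<lambda>x. norm (g x))"
  unfolding mem_Lp_def by auto

lemma mem_Lp_cmult:
  fixes g :: "real \<Rightarrow> 'a::{euclidean_space,real_normed_field}"
  assumes "mem_Lp p g"
  shows "mem_Lp p (\<lambda>x. c * g x)"
  using assms unfolding mem_Lp_def by (auto simp: norm_mult powr_mult)

lemma mem_Lp_sum:
  fixes g :: "'i \<Rightarrow> real \<Rightarrow> 'a::euclidean_space"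
  assumes "finite B" "\<And>k. k \<in> B \<Longrightarrow> mem_Lp p (g k)" "0 \<le> p"
  shows "mem_Lp p (\<lambda>x. \<Sum>k\<in>B. g k x)"
proof -
  have [measurable]: "(\<lambda>x. \<Sum>k\<in>B. g k x) \<in> borel_measurable period_measure"
    using assms(2) by (intro borel_measurable_sum) (simp add: mem_Lp_def)
  have "integrable period_measure (\<lambda>x. norm (\<Sum>k\<in>B. g k x) powr p)"
  proof (rule Bochner_Integration.integrable_bound)
    show "integrable period_measure (\<lambda>x. real (card B) powr p * (\<Sum>k\<in>B. norm (g k x) powr p))"
      using assms(2) by (intro integrable_mult_right Bochner_Integration.integrable_sum) (simp add: mem_Lp_def)
    have "norm (\<Sum>k\<in>B. g k x) powr p \<le> real (card B) powr p * (\<Sum>k\<in>B. norm (g k x) powr p)" for x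
      using assms by (intro order.trans[OF powr_mono2[OF _ _ norm_sum] sum_powr_le]) auto
    then show "AE x in period_measure. norm (norm (\<Sum>k\<in>B. g k x) powr p)
       \<le> norm (real (card B) powr p * (\<Sum>k\<in>B. norm (g k x) powr p))"
      by (smt (verit, best) AE_I2 norm_ge_zero real_norm_def powr_ge_zero)
  qed measurable
  then show ?thesis by (simp add: mem_Lp_def)
qed

lemma mem_Lp_add:
  fixes g h :: "real \<Rightarrow> 'a::euclidean_space"
  assumes "mem_Lp p g" "mem_Lp p h" "0 \<le> p"
  shows "mem_Lp p (\<lambda>x. g x + h x)"
  using mem_Lp_sum[of "{True, False}" p "\<lambda>b. if b then g else h"] assms by simp

lemma mem_Lp_diff:
  fixes g h :: "real \<Rightarrow> 'a::euclidean_space"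
  assumes "mem_Lp p g" "mem_Lp p h" "0 \<le> p"
  shows "mem_Lp p (\<lambda>x. g x - h x)"
  using mem_Lp_add[of p g "\<lambda>x. - h x"] assms by (simp add: mem_Lp_def)

text \<open>The period has finite measure, so constants are integrable, and
  \<open>y \<le> 1 + y powr p\<close> for \<open>y \<ge> 0\<close> gives a majorant.\<close>

lemma mem_Lp_integrable:
  fixes g :: "real \<Rightarrow> 'a::euclidean_space"
  assumes "mem_Lp p g" "1 \<le> p"
  shows "integrable period_measure g"
proof (rule Bochner_Integration.integrable_bound)
  show "integrable period_measure (\<lambda>x. 1 + norm (g x) powr p)"
    using assms by (auto simp: mem_Lp_def)
  have "y \<le> 1 + y powr p" if "0 \<le> y" for y :: real
  proof (cases "y \<le> 1")
    case False
    then have "y powr 1 \<le> y powr p" using assms(2) by (intro powr_mono) auto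
    then show ?thesis using False by simp
  qed (smt (verit) powr_ge_zero)
  then show "AE x in period_measure. norm (g x) \<le> norm (1 + norm (g x) powr p)"
    by (smt (verit, best) AE_I2 norm_ge_zero real_norm_def powr_ge_zero)
qed (use assms in \<open>simp add: mem_Lp_def\<close>)

lemma Lp_norm_nonneg: "0 \<le> Lp_norm p g"
  by (simp add: Lp_norm_def)

text \<open>The factor lost against Minkowski's inequality depends only on \<open>card B\<close>, which will be at most \<open>r + 1\<close>.\<close>

lemma Lp_norm_le_sum:
  fixes g :: "'i \<Rightarrow> real \<Rightarrow> real" and h :: "real \<Rightarrow> real"
  assumes "finite B" "\<And>k. k \<in> B \<Longrightarrow> mem_Lp p (g k)" "1 \<le> p" "0 \<le> C" "0 \<le> e"
    and "\<And>k. k \<in> B \<Longrightarrow> Lp_norm p (g k) \<le> e"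
    and "\<And>x k. k \<in> B \<Longrightarrow> 0 \<le> g k x"
    and "\<And>x. 0 \<le> h x" "\<And>x. h x \<le> C * (\<Sum>k\<in>B. g k x)"
  shows "Lp_norm p h \<le> C * real (card B) ^ 2 * e"
proof -
  let ?N = "real (card B)"
  have int: "(\<integral>x. g k x powr p \<partial>period_measure) \<le> e powr p" if "k \<in> B" for k
  proof -
    have "(\<integral>x. g k x powr p \<partial>period_measure) = Lp_norm p (g k) powr p"
      using assms(3,7) that by (simp add: Lp_norm_def powr_powr)
    also have "\<dots> \<le> e powr p"
      using assms(3) assms(6)[OF that] by (intro powr_mono2) (auto simp: Lp_norm_nonneg)
    finally show ?thesis .
  qed
  have intg: "integrable period_measure (\<lambda>x. g k x powr p)" if "k \<in> B" for k
    using assms(2)[OF that] assms(7)[OF that] by (simp add: mem_Lp_def)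
  have "(\<integral>x. norm (h x) powr p \<partial>period_measure)
      \<le> (\<integral>x. C powr p * ?N powr p * (\<Sum>k\<in>B. g k x powr p) \<partial>period_measure)"
  \<comment> \<open>Integrability is asked of the majorant alone, because a non-integrable left side
    has integral 0 by default. This is why \<open>h\<close> enters through pointwise bounds
    only.\<close>
  proof (rule integral_mono')
    show "integrable period_measure (\<lambda>x. C powr p * ?N powr p * (\<Sum>k\<in>B. g k x powr p))"
      by (intro integrable_mult_right Bochner_Integration.integrable_sum intg)
    show "norm (h x) powr p \<le> C powr p * ?N powr p * (\<Sum>k\<in>B. g k x powr p)" for x
    proof -
      have "norm (h x) powr p \<le> (C * (\<Sum>k\<in>B. g k x)) powr p"
        using assms(3) assms(8,9)[of x] by (intro powr_mono2) auto
      also have "\<dots> = C powr p * (\<Sum>k\<in>B. g k x) powr p"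
        using assms(4,7) by (simp add: powr_mult sum_nonneg)
      also have "\<dots> \<le> C powr p * (?N powr p * (\<Sum>k\<in>B. g k x powr p))"
        using assms by (intro mult_left_mono sum_powr_le) auto
      finally show ?thesis by (simp add: mult.assoc)
    qed
  qed (auto intro!: mult_nonneg_nonneg sum_nonneg)
  also have "\<dots> = C powr p * ?N powr p * (\<Sum>k\<in>B. (\<integral>x. g k x powr p \<partial>period_measure))"
    using intg by simp
  also have "\<dots> \<le> C powr p * ?N powr p * (?N * e powr p)"
    using int by (intro mult_left_mono sum_bounded_above) auto
  \<comment> \<open>The number of summands is weakened to its \<open>p\<close>th power, so that the
    bound becomes a perfect \<open>p\<close>th power before the root is taken.\<close>
  also have "\<dots> \<le> C powr p * ?N powr p * (?N powr p * e powr p)"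
  proof (intro mult_left_mono mult_right_mono)
    show "?N \<le> ?N powr p"
      using powr_mono[of 1 p ?N] assms(3) by (cases "card B = 0") auto
  qed auto
  also have "\<dots> = (C * ?N ^ 2 * e) powr p"
    using assms by (simp add: powr_mult power2_eq_square)
  finally have "Lp_norm p h \<le> ((C * ?N ^ 2 * e) powr p) powr (1 / p)"
    unfolding Lp_norm_def using assms(3) by (intro powr_mono2) auto
  also have "\<dots> = C * ?N ^ 2 * e"
    using assms by (simp add: powr_powr)
  finally show ?thesis .
qed

section \<open>Fourier coefficients and partial sums of a remainder\<close>

lemma integrable_mult_cos_sin:
  fixes f :: "real \<Rightarrow> complex" and c :: real
  assumes "integrable period_measure f"
  shows "integrable period_measure (\<lambda>t. f t * of_real (cos (c * t)))"
    and "integrable period_measure (\<lambda>t. f t * of_real (sin (c * t)))"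
proof -
  have [measurable]: "f \<in> borel_measurable period_measure" using assms by auto
  have [measurable]: "(\<lambda>t. cos (c * t)) \<in> borel_measurable period_measure"
    "(\<lambda>t. sin (c * t)) \<in> borel_measurable period_measure"
    using integrable_cos_sin by blast+
  show "integrable period_measure (\<lambda>t. f t * of_real (cos (c * t)))"
    by (rule Bochner_Integration.integrable_bound[OF assms]) (auto simp: norm_mult mult_left_le)
  show "integrable period_measure (\<lambda>t. f t * of_real (sin (c * t)))"
    by (rule Bochner_Integration.integrable_bound[OF assms]) (auto simp: norm_mult mult_left_le)
qed

lemma fourier_coeff_diff:
  assumes "integrable period_measure f" "integrable period_measure g"
  shows "fourier_cos_coeff (\<lambda>x. f x - g x) k = fourier_cos_coeff f k - fourier_cos_coeff g k"
    and "fourier_sin_coeff (\<lambda>x. f x - g x) k = fourier_sin_coeff f k - fourier_sin_coeff g k"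
  unfolding fourier_cos_coeff_def fourier_sin_coeff_def left_diff_distrib
    Bochner_Integration.integral_diff[OF integrable_mult_cos_sin(1)[OF assms(1)] integrable_mult_cos_sin(1)[OF assms(2)]]
    Bochner_Integration.integral_diff[OF integrable_mult_cos_sin(2)[OF assms(1)] integrable_mult_cos_sin(2)[OF assms(2)]]
  by (rule diff_divide_distrib)+

text \<open>A trigonometric polynomial is continuous and bounded by the sum of the norms of its
  coefficients, whatever numbers these are.\<close>

lemma mem_Lp_fourier_partial_sum:
  assumes "0 \<le> p"
  shows "mem_Lp p (fourier_partial_sum n f)"
proof -
  have "continuous_on {-pi..pi} (fourier_partial_sum n f)"
    unfolding fourier_partial_sum_def by (intro continuous_intros)
  then have m: "fourier_partial_sum n f \<in> borel_measurable period_measure"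
    by (rule borel_measurable_integrable[OF continuous_imp_integrable_real])
  define M where "M = norm (fourier_cos_coeff f 0 / 2) +
    (\<Sum>k=1..n. norm (fourier_cos_coeff f k) + norm (fourier_sin_coeff f k))"
  have "norm (fourier_partial_sum n f x) \<le> M" for x
    unfolding M_def fourier_partial_sum_def
    by (intro order.trans[OF norm_triangle_ineq] add_mono order.refl sum_norm_le)
       (auto simp: norm_mult mult_left_le)
  then show ?thesis
    using m assms by (intro mem_Lp_mono[OF mem_Lp_const[of p M]]) (auto intro: order.trans[OF _ abs_ge_self])
qed

lemma integral_trig_complex:
  "(\<integral>t. complex_of_real (cos (real j * t)) * of_real (cos (real k * t)) \<partial>period_measure)
     = (if j = k then if k = 0 then 2 * pi else pi else 0)"
  "(\<integral>t. complex_of_real (sin (real j * t)) * of_real (sin (real k * t)) \<partial>period_measure)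
     = (if j = k \<and> k \<noteq> 0 then pi else 0)"
  "(\<integral>t. complex_of_real (sin (real j * t)) * of_real (cos (real k * t)) \<partial>period_measure) = 0"
  "(\<integral>t. complex_of_real (cos (real j * t)) * of_real (sin (real k * t)) \<partial>period_measure) = 0"
  unfolding of_real_mult[symmetric] integral_complex_of_real integral_cos_cos integral_sin_sin integral_sin_cos
    mult.commute[of "cos (real j * _)" "sin (real k * _)"]
  by simp_all

lemma fourier_coeff_partial_sum:
  shows "fourier_cos_coeff (fourier_partial_sum m f) k = (if k \<le> m then fourier_cos_coeff f k else 0)"
    and "k \<noteq> 0 \<Longrightarrow> fourier_sin_coeff (fourier_partial_sum m f) k = (if k \<le> m then fourier_sin_coeff f k else 0)"
proof -
  \<comment> \<open>The constant term joins the sum as index 0. Its halved coefficient compensates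
    for the cosine integral, which is \<open>2 * pi\<close> there instead of \<open>pi\<close>; the
    sine term at 0 vanishes.\<close>
  let ?a = "\<lambda>j. if j = 0 then fourier_cos_coeff f 0 / 2 else fourier_cos_coeff f j"
  let ?b = "fourier_sin_coeff f"
  have S: "fourier_partial_sum m f x = (\<Sum>j\<le>m. ?a j * of_real (cos (real j * x)) + ?b j * of_real (sin (real j * x)))" for x
    unfolding fourier_partial_sum_def by (simp add: sum.atLeast_Suc_atMost[of 0 m] flip: atLeast0AtMost)
  have [simp]: "integrable period_measure (\<lambda>t. complex_of_real (cos (real j * t)))"
    "integrable period_measure (\<lambda>t. complex_of_real (sin (real j * t)))" for j
    by (simp_all add: integrable_of_real)
  note [simp] = integrable_mult_cos_sin
  have "(\<integral>t. fourier_partial_sum m f t * of_real (cos (real k * t)) \<partial>period_measure)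
    = (\<Sum>j\<le>m. ?a j * (\<integral>t. complex_of_real (cos (real j * t)) * of_real (cos (real k * t)) \<partial>period_measure)
       + ?b j * (\<integral>t. complex_of_real (sin (real j * t)) * of_real (cos (real k * t)) \<partial>period_measure))"
    unfolding S sum_distrib_right by (simp add: distrib_right mult.assoc)
  also have "\<dots> = (\<Sum>j\<le>m. if j = k then fourier_cos_coeff f k * pi else 0)"
    unfolding integral_trig_complex by (intro sum.cong) auto
  finally show "fourier_cos_coeff (fourier_partial_sum m f) k = (if k \<le> m then fourier_cos_coeff f k else 0)"
    by (simp add: fourier_cos_coeff_def)
  assume "k \<noteq> 0"
  have "(\<integral>t. fourier_partial_sum m f t * of_real (sin (real k * t)) \<partial>period_measure)
    = (\<Sum>j\<le>m. ?a j * (\<integral>t. complex_of_real (cos (real j * t)) * of_real (sin (real k * t)) \<partial>period_measure)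
       + ?b j * (\<integral>t. complex_of_real (sin (real j * t)) * of_real (sin (real k * t)) \<partial>period_measure))"
    unfolding S sum_distrib_right by (simp add: distrib_right mult.assoc)
  also have "\<dots> = (\<Sum>j\<le>m. if j = k then fourier_sin_coeff f k * pi else 0)"
    unfolding integral_trig_complex using \<open>k \<noteq> 0\<close> by (intro sum.cong) auto
  finally show "fourier_sin_coeff (fourier_partial_sum m f) k = (if k \<le> m then fourier_sin_coeff f k else 0)"
    by (simp add: fourier_sin_coeff_def)
qed

text \<open>By orthogonality \<open>fourier_partial_sum m f\<close> has the coefficients of
  \<open>f\<close> cut off at \<open>m\<close>, so its \<open>k\<close>th partial sum is the one of
  \<open>f\<close> with index \<open>min k m\<close>. Integrability of \<open>f\<close> makes the
  coefficients of the difference split.\<close>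

lemma fourier_partial_sum_diff:
  assumes "integrable period_measure f"
  shows "fourier_partial_sum k (\<lambda>x. fourier_partial_sum m f x - f x) x
       = fourier_partial_sum (min k m) f x - fourier_partial_sum k f x"
proof -
  have i: "integrable period_measure (fourier_partial_sum m f)"
    using mem_Lp_integrable[OF mem_Lp_fourier_partial_sum[of 1]] by auto
  have *: "(\<Sum>j=1..min k m. fourier_cos_coeff f j * of_real (cos (real j * x)) + fourier_sin_coeff f j * of_real (sin (real j * x)))
    = (\<Sum>j=1..k. (if j \<le> m then fourier_cos_coeff f j else 0) * of_real (cos (real j * x)) + (if j \<le> m then fourier_sin_coeff f j else 0) * of_real (sin (real j * x)))"
    by (intro sum.mono_neutral_cong_left) auto
  show ?thesis
    unfolding fourier_partial_sum_def[of k] fourier_partial_sum_def[of "min k m"] *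
      fourier_coeff_diff[OF i assms] fourier_coeff_partial_sum(1)
      sum_subtractf[symmetric] add_diff_add
    by (intro arg_cong2[where f="(+)"] sum.cong)
       (auto simp: fourier_coeff_partial_sum(2) diff_divide_distrib left_diff_distrib)
qed

section \<open>Strong deviations and strong means of a remainder\<close>

text \<open>At a negative lagged index the second factor is \<open>- c\<close>, not 0; the product
  vanishes because the extended weight does.\<close>

lemma zero_ext_lag_diff:
  "of_real (zero_ext l (int k)) * (zero_ext s (int k) - c)
     - of_real (zero_ext l (int k - int r)) * (zero_ext s (int k - int r) - c)
   = of_real (l k) * (s k - c) - (if k < r then 0 else of_real (l (k - r)) * (s (k - r) - c :: complex))"
  by (auto simp: zero_ext_def nat_diff_distrib)

lemma strong_deviation_eq:
  "strong_deviation l r f n x = 1 / l n * (\<Sum>k\<le>n. norm (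
     of_real (l k) * (fourier_partial_sum k f x - f x)
     - (if k < r then 0 else of_real (l (k - r)) * (fourier_partial_sum (k - r) f x - f x))))"
  unfolding strong_deviation_def zero_ext_lag_diff atLeast0AtMost ..

lemma strong_mean_eq:
  "strong_mean l r f n x = 1 / l n * (\<Sum>k\<le>n. norm (
     of_real (l k) * fourier_partial_sum k f x
     - (if k < r then 0 else of_real (l (k - r)) * fourier_partial_sum (k - r) f x)))"
  unfolding strong_mean_def atLeast0AtMost
  \<comment> \<open>A strong mean has the shape of a strong deviation from the constant 0.\<close>
  using zero_ext_lag_diff[where c = 0, unfolded diff_0_right] by simp

lemma strong_deviation_nonneg: "0 < l n \<Longrightarrow> 0 \<le> strong_deviation l r f n x"
  unfolding strong_deviation_def by (intro mult_nonneg_nonneg sum_nonneg) auto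

lemma strong_mean_nonneg: "0 < l n \<Longrightarrow> 0 \<le> strong_mean l r f n x"
  unfolding strong_mean_def by (intro mult_nonneg_nonneg sum_nonneg) auto

lemma mem_Lp_strong_deviation:
  assumes "mem_Lp p f" "0 \<le> p"
  shows "mem_Lp p (strong_deviation l r f n)"
proof -
  have E: "mem_Lp p (\<lambda>x. of_real c * (fourier_partial_sum k f x - f x))" for c k
    by (intro mem_Lp_cmult mem_Lp_diff mem_Lp_fourier_partial_sum assms)
  have "mem_Lp p (\<lambda>x. of_real (l k) * (fourier_partial_sum k f x - f x)
      - (if k < r then 0 else of_real (l (k - r)) * (fourier_partial_sum (k - r) f x - f x)))" for k
    using E E[of 0] by (cases "k < r") (auto intro: mem_Lp_diff[OF _ _ assms(2)])
  then show ?thesis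
    unfolding strong_deviation_eq[abs_def]
    by (intro mem_Lp_cmult mem_Lp_sum mem_Lp_norm assms(2)) simp_all
qed

text \<open>For \<open>n < m\<close> the strong mean is 0, since it only sees partial sums of the
  remainder up to index \<open>n\<close>. Writing \<open>max m n\<close> merges this case with
  \<open>m \<le> n\<close> and keeps every deviation index at least \<open>m\<close>.\<close>

lemma strong_mean_remainder_le:
  assumes "mono l" "\<And>k. 0 < l k" "0 < r" "integrable period_measure f"
  shows "strong_mean l r (\<lambda>x. fourier_partial_sum m f x - f x) n x
    \<le> (2 * real r + 2) * (\<Sum>k\<in>insert (max m n) {m..<m+r}. strong_deviation l r f k x)"
proof (cases "m \<le> n")
  case True
  then show ?thesis
    using lag_mean_truncation_le[where l = l and r = r and m = m and n = n and F = "f x"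
        and S = "\<lambda>k. fourier_partial_sum k f x", OF assms(1,2,3) True]
    by (simp only: strong_mean_eq strong_deviation_eq fourier_partial_sum_diff[OF assms(4)] max_absorb2)
next
  case False
  then have "strong_mean l r (\<lambda>x. fourier_partial_sum m f x - f x) n x = 0"
    by (auto simp: strong_mean_eq fourier_partial_sum_diff[OF assms(4)] min_def intro!: sum.neutral)
  then show ?thesis
    using assms(2) by (auto intro!: mult_nonneg_nonneg sum_nonneg strong_deviation_nonneg)
qed

theorem theorem10:
  fixes l :: "nat \<Rightarrow> real" and r :: nat and p :: real and f :: "real \<Rightarrow> complex"
  assumes "mono l"
    and "\<And>k. 0 < l k"
    and "filterlim l at_top sequentially"
    and "2 \<le> r"
    and "1 \<le> p"
    and "f \<in> Sp_space p l r"
  shows "(\<lambda>m. Sp_norm p l r (\<lambda>x. fourier_partial_sum m f x - f x)) \<longlonglongrightarrow> 0"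
proof (rule order_tendstoI)
  have f: "mem_Lp p f"
    using assms(6) by (auto simp: Sp_space_def Lp_space_def mem_Lp_def intro: measurable_restrict_space1)
  then have int: "integrable period_measure f"
    using mem_Lp_integrable assms(5) by blast
  \<comment> \<open>The pointwise constant times the square of the largest possible number of
    deviations, as \<open>Lp_norm_le_sum\<close> will produce it.\<close>
  define C where "C = (2 * real r + 2) * (real r + 1) ^ 2"
  have C: "0 < C" by (simp add: C_def add_nonneg_pos)
  fix a :: ennreal
  assume "0 < a"
  then obtain b where b: "0 < b" "b < a" using dense by blast
  \<comment> \<open>Lying strictly below \<open>a\<close>, the value \<open>b\<close> is finite even
    when \<open>a\<close> is infinite, so it comes from a positive real.\<close>
  then obtain d where d: "0 < d" "ennreal d < a"
    by (cases b) auto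
  have "(\<lambda>n. Lp_norm p (strong_deviation l r f n)) \<longlonglongrightarrow> 0"
    using assms(6) by (simp add: Sp_space_def)
  then have "\<forall>\<^sub>F n in sequentially. Lp_norm p (strong_deviation l r f n) < d / C"
    using d(1) C by (intro order_tendstoD) auto
  then obtain N where N: "Lp_norm p (strong_deviation l r f n) < d / C" if "N \<le> n" for n
    by (auto simp: eventually_sequentially)
  show "\<forall>\<^sub>F m in sequentially. Sp_norm p l r (\<lambda>x. fourier_partial_sum m f x - f x) < a"
  proof (rule eventually_sequentiallyI)
    fix m assume m: "N \<le> m"
    have "Lp_norm p (strong_mean l r (\<lambda>x. fourier_partial_sum m f x - f x) n) \<le> d" for n
    proof -
      let ?B = "insert (max m n) {m..<m+r}"
      have "Lp_norm p (strong_mean l r (\<lambda>x. fourier_partial_sum m f x - f x) n)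
          \<le> (2 * real r + 2) * real (card ?B) ^ 2 * (d / C)"
      proof (rule Lp_norm_le_sum)
        \<comment> \<open>Every index in \<open>?B\<close> is at least \<open>m\<close>, hence at
          least \<open>N\<close>, whatever \<open>n\<close> is; this gives the uniformity that the
          supremum requires.\<close>
        show "Lp_norm p (strong_deviation l r f k) \<le> d / C" if "k \<in> ?B" for k
          using N[of k] m that by (intro less_imp_le) auto
        show "mem_Lp p (strong_deviation l r f k)" for k
          using f assms(5) by (intro mem_Lp_strong_deviation) auto
        show "strong_mean l r (\<lambda>x. fourier_partial_sum m f x - f x) n x
            \<le> (2 * real r + 2) * (\<Sum>k\<in>?B. strong_deviation l r f k x)" for x
          using assms(4) by (intro strong_mean_remainder_le[OF assms(1,2) _ int]) auto
      qed (use assms(2,5) C d(1) in \<open>auto intro: strong_deviation_nonneg strong_mean_nonneg\<close>)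
      also have "\<dots> \<le> (2 * real r + 2) * (real r + 1) ^ 2 * (d / C)"
      proof (intro mult_right_mono mult_left_mono power_mono)
        show "real (card ?B) \<le> real r + 1"
          using card_insert_le_m1[of "r + 1" "{m..<m+r}" "max m n"] by simp
      qed (use C d(1) in auto)
      also have "\<dots> = d" using C by (simp add: C_def)
      finally show ?thesis .
    qed
    then have "Sp_norm p l r (\<lambda>x. fourier_partial_sum m f x - f x) \<le> ennreal d"
      unfolding Sp_norm_def by (intro SUP_least ennreal_leI)
    then show "Sp_norm p l r (\<lambda>x. fourier_partial_sum m f x - f x) < a"
      using d(2) by simp
  qed
qed simp

end
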